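(* For $\kappa>0$ let $\mu_\kappa:=c_\kappa^{-1}e^{-2\kappa\phi}\,\mathrm{vol}$ with $c_\kappa:=\int_{\mathcal M}e^{-2\kappa\phi}\,\mathrm{vol}$, and let $S_\star:=\{x\in\mathcal M:\phi(x)=\min_{\mathcal M}\phi\}$. For every closed $K\subseteq\mathcal M$ with $K\cap S_\star=\emptyset$ there exist $C_K,c_K>0$ such that $$\mu_\kappa(K)\le C_K\,e^{-2\kappa c_K}\qquad\text{for all }\kappa>0.$$ In particular, $\mu_\kappa(U)\to1$ as $\kappa\to\infty$ for every open $U\supset S_\star$.
   Context: $\mathcal M$ is a smooth, connected, compact, orientable $n$-dimensional manifold without boundary, embedded in $\mathbb R^m$, and $\phi\in C^\infty(\mathcal M)$. $\mathcal F=\{f_1,\dots,f_r\}$ is a family of smooth vector fields on $\mathcal M$ with $\operatorname{span}_{\mathbb R}\{f_1(x),\dots,f_r(x)\}=T_x\mathcal M$ for all $x\in\mathcal M$. By this span condition there is a unique Riemannian metric on $\mathcal M$ such that $\operatorname{grad}\psi=\sum_{i=1}^r f_i(\psi)f_i$ for all $\psi\in C^\infty(\mathcal M)$, and $\mathrm{vol}$ is the Riemannian density of this metric. *)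

theory Defs
  imports "HOL-Analysis.Analysis"
begin

primrec C_k_on :: "nat \<Rightarrow> 'a::euclidean_space set \<Rightarrow> ('a \<Rightarrow> 'b::euclidean_space) \<Rightarrow> bool" where
  "C_k_on 0 S F \<longleftrightarrow> continuous_on S F"
| "C_k_on (Suc k) S F \<longleftrightarrow>
     (\<forall>x\<in>S. F differentiable (at x)) \<and>
     (\<forall>v. C_k_on k S (\<lambda>x. frechet_derivative F (at x) v))"

text \<open>Only meaningful for open \<open>S\<close>, because the derivatives are taken in the full space.\<close>

definition smooth_on_open :: "'a::euclidean_space set \<Rightarrow> ('a \<Rightarrow> 'b::euclidean_space) \<Rightarrow> bool" where
  "smooth_on_open S F \<longleftrightarrow> (\<forall>k. C_k_on k S F)"

text \<open>Smoothness on an arbitrary subset of Euclidean space: locally the restriction of a smooth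
  map of the ambient space.  The values of \<open>F\<close> outside \<open>M\<close> are irrelevant.\<close>

definition smooth_on_subset :: "'a::euclidean_space set \<Rightarrow> ('a \<Rightarrow> 'b::euclidean_space) \<Rightarrow> bool" where
  "smooth_on_subset M F \<longleftrightarrow>
     (\<forall>p\<in>M. \<exists>U G. open U \<and> p \<in> U \<and> smooth_on_open U G \<and> (\<forall>x\<in>M \<inter> U. G x = F x))"

text \<open>The dimension of a submanifold is \<open>CARD('n)\<close>, where \<open>'n\<close> indexes the coordinates of
  the parameter domains.\<close>

definition local_parametrization ::
    "'a::euclidean_space set \<Rightarrow> (real^'n) set \<Rightarrow> (real^'n \<Rightarrow> 'a) \<Rightarrow> bool" where
  "local_parametrization M V \<sigma> \<longleftrightarrow>
     open V \<and> smooth_on_open V \<sigma> \<and>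
     (\<forall>u\<in>V. inj (frechet_derivative \<sigma> (at u))) \<and>
     openin (top_of_set M) (\<sigma> ` V) \<and>
     homeomorphism V (\<sigma> ` V) \<sigma> (inv_into V \<sigma>)"

definition embedded_submanifold :: "'n::finite itself \<Rightarrow> 'a::euclidean_space set \<Rightarrow> bool" where
  "embedded_submanifold TYPE('n) M \<longleftrightarrow>
     (\<forall>p\<in>M. \<exists>(V :: (real^'n) set) \<sigma>. local_parametrization M V \<sigma> \<and> p \<in> \<sigma> ` V)"

definition orientable_submanifold :: "'n::finite itself \<Rightarrow> 'a::euclidean_space set \<Rightarrow> bool" where
  "orientable_submanifold TYPE('n) M \<longleftrightarrow>
     (\<exists>\<A> :: ((real^'n) set \<times> (real^'n \<Rightarrow> 'a)) set.
        (\<forall>(V, \<sigma>)\<in>\<A>. local_parametrization M V \<sigma>) \<and>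
        M = (\<Union>(V, \<sigma>)\<in>\<A>. \<sigma> ` V) \<and>
        (\<forall>(V, \<sigma>)\<in>\<A>. \<forall>(W, \<tau>)\<in>\<A>. \<forall>w\<in>W. \<tau> w \<in> \<sigma> ` V \<longrightarrow>
           det (matrix (frechet_derivative (inv_into V \<sigma> \<circ> \<tau>) (at w))) > 0))"

definition curve_with_velocity ::
    "'a::euclidean_space set \<Rightarrow> 'a \<Rightarrow> 'a \<Rightarrow> (real \<Rightarrow> 'a) \<Rightarrow> bool" where
  "curve_with_velocity M x v c \<longleftrightarrow>
     (\<exists>e>0. smooth_on_open {-e<..<e} c \<and> c ` {-e<..<e} \<subseteq> M) \<and>
     c 0 = x \<and> (c has_vector_derivative v) (at 0)"

definition tangent_space :: "'a::euclidean_space set \<Rightarrow> 'a \<Rightarrow> 'a set" where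
  "tangent_space M x = {v. \<exists>c. curve_with_velocity M x v c}"

definition smooth_vector_field :: "'a::euclidean_space set \<Rightarrow> ('a \<Rightarrow> 'a) \<Rightarrow> bool" where
  "smooth_vector_field M X \<longleftrightarrow> smooth_on_subset M X \<and> (\<forall>x\<in>M. X x \<in> tangent_space M x)"

text \<open>For \<open>\<psi>\<close> smooth on \<open>M\<close> and \<open>v\<close> tangent to \<open>M\<close> at \<open>x\<close>, the derivative of \<open>\<psi>\<close> along a curve
  depends only on its velocity.\<close>

definition differential ::
    "'a::euclidean_space set \<Rightarrow> ('a \<Rightarrow> real) \<Rightarrow> 'a \<Rightarrow> 'a \<Rightarrow> real" where
  "differential M \<psi> x v =
     (THE d. \<forall>c. curve_with_velocity M x v c \<longrightarrow> ((\<lambda>t. \<psi> (c t)) has_real_derivative d) (at 0))"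

definition lie_derivative ::
    "'a::euclidean_space set \<Rightarrow> ('a \<Rightarrow> 'a) \<Rightarrow> ('a \<Rightarrow> real) \<Rightarrow> 'a \<Rightarrow> real" where
  "lie_derivative M X \<psi> x = differential M \<psi> x (X x)"

text \<open>A metric is a function \<open>g\<close> whose value \<open>g x v w\<close> matters only for \<open>x \<in> M\<close> and \<open>v\<close>,
  \<open>w\<close> tangent to \<open>M\<close> at \<open>x\<close>.\<close>

definition metric_matrix ::
    "('a::euclidean_space \<Rightarrow> 'a \<Rightarrow> 'a \<Rightarrow> real) \<Rightarrow> (real^'n \<Rightarrow> 'a) \<Rightarrow> real^'n \<Rightarrow> real^'n^'n" where
  "metric_matrix g \<sigma> u =
     (\<chi> i j. g (\<sigma> u) (frechet_derivative \<sigma> (at u) (axis i 1))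
                     (frechet_derivative \<sigma> (at u) (axis j 1)))"

definition riemannian_metric ::
    "'n::finite itself \<Rightarrow> 'a::euclidean_space set \<Rightarrow> ('a \<Rightarrow> 'a \<Rightarrow> 'a \<Rightarrow> real) \<Rightarrow> bool" where
  "riemannian_metric TYPE('n) M g \<longleftrightarrow>
     (\<forall>x\<in>M.
        (\<forall>v\<in>tangent_space M x. \<forall>w\<in>tangent_space M x. g x v w = g x w v) \<and>
        (\<forall>v\<in>tangent_space M x. \<forall>w\<in>tangent_space M x. \<forall>z\<in>tangent_space M x. \<forall>a b.
           g x (a *\<^sub>R v + b *\<^sub>R w) z = a * g x v z + b * g x w z) \<and>
        (\<forall>v\<in>tangent_space M x. v \<noteq> 0 \<longrightarrow> g x v v > 0)) \<and>
     (\<forall>(V :: (real^'n) set) \<sigma>. local_parametrization M V \<sigma> \<longrightarrow>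
        (\<forall>i j. smooth_on_open V (\<lambda>u. metric_matrix g \<sigma> u $ i $ j)))"

definition riemannian_gradient ::
    "'a::euclidean_space set \<Rightarrow> ('a \<Rightarrow> 'a \<Rightarrow> 'a \<Rightarrow> real) \<Rightarrow> ('a \<Rightarrow> real) \<Rightarrow> 'a \<Rightarrow> 'a" where
  "riemannian_gradient M g \<psi> x =
     (THE v. v \<in> tangent_space M x \<and>
        (\<forall>w\<in>tangent_space M x. g x v w = differential M \<psi> x w))"

text \<open>The Riemannian density as a Borel measure on \<open>M\<close>.  The formula in local coordinates, over
  all parametrizations, determines it uniquely when \<open>M\<close> is a submanifold.\<close>

definition riemannian_density ::
    "'n::finite itself \<Rightarrow> 'a::euclidean_space set \<Rightarrow> ('a \<Rightarrow> 'a \<Rightarrow> 'a \<Rightarrow> real) \<Rightarrow> 'a measure \<Rightarrow> bool" where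
  "riemannian_density TYPE('n) M g vol \<longleftrightarrow>
     space vol = M \<and> sets vol = sets (restrict_space borel M) \<and>
     (\<forall>(V :: (real^'n) set) \<sigma> A. local_parametrization M V \<sigma> \<and> A \<in> sets vol \<and> A \<subseteq> \<sigma> ` V \<longrightarrow>
        emeasure vol A =
          (\<integral>\<^sup>+u. ennreal (sqrt (det (metric_matrix g \<sigma> u))) * indicator (V \<inter> \<sigma> -` A) u \<partial>lborel))"

definition gibbs_constant :: "'a measure \<Rightarrow> ('a \<Rightarrow> real) \<Rightarrow> real \<Rightarrow> real" where
  "gibbs_constant vol \<phi> \<kappa> = (\<integral>x. exp (- 2 * \<kappa> * \<phi> x) \<partial>vol)"

definition gibbs_measure :: "'a measure \<Rightarrow> ('a \<Rightarrow> real) \<Rightarrow> real \<Rightarrow> 'a measure" where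
  "gibbs_measure vol \<phi> \<kappa> =
     density vol (\<lambda>x. ennreal (exp (- 2 * \<kappa> * \<phi> x) / gibbs_constant vol \<phi> \<kappa>))"

definition minimizers :: "'a set \<Rightarrow> ('a \<Rightarrow> real) \<Rightarrow> 'a set" where
  "minimizers M \<phi> = {x \<in> M. \<phi> x = (INF y\<in>M. \<phi> y)}"

end

theory Submission
  imports Defs "HOL-Probability.Probability_Measure" "HOL-Real_Asymp.Real_Asymp"
begin

text \<open>By compactness of \<open>M\<close>, the volume is finite, and every nonempty open subset has positive
  volume because the metric matrix in a chart is positive definite.  If \<open>\<phi> \<ge> m + 2 \<delta>\<close> on \<open>K\<close>, where
  \<open>m\<close> is the minimum of \<open>\<phi>\<close>, then the set \<open>{\<phi> < m + \<delta>}\<close> alone bounds the normalising constant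
  from below, and the common factor \<open>exp (- 2 \<kappa> m)\<close> cancels in the quotient.\<close>

subsection \<open>Smooth functions\<close>

text \<open>Since \<open>S\<close> is open, agreement on \<open>S\<close> gives agreement near each
  of its points, so the Frechet derivatives agree there too. The induction then runs on the
  directional derivatives.\<close>

lemma C_k_on_cong:
  assumes "open S" "\<And>x. x \<in> S \<Longrightarrow> F x = G x" "C_k_on k S F"
  shows "C_k_on k S G"
  using assms(2,3)
proof (induction k arbitrary: F G)
  case 0
  then show ?case using continuous_on_eq[of S F G] by simp
next
  case (Suc k)
  have deriv: "(G has_derivative frechet_derivative F (at x)) (at x)" if "x \<in> S" for x
  proof (rule has_derivative_transform_within_open[OF _ \<open>open S\<close> that Suc.prems(1)])
    show "(F has_derivative frechet_derivative F (at x)) (at x)"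
      using Suc.prems(2) that by (simp add: frechet_derivative_works)
  qed
  have eq: "frechet_derivative G (at x) = frechet_derivative F (at x)" if "x \<in> S" for x
    using frechet_derivative_at[OF deriv[OF that]] by (rule sym)
  have "G differentiable (at x)" if "x \<in> S" for x
    using deriv[OF that] by (rule differentiableI)
  moreover have "C_k_on k S (\<lambda>x. frechet_derivative G (at x) v)" for v
  proof (rule Suc.IH)
    show "C_k_on k S (\<lambda>x. frechet_derivative F (at x) v)" using Suc.prems(2) by simp
  qed (simp add: eq)
  ultimately show ?case by simp
qed

lemma C_k_on_scaleR:
  assumes "open S" "C_k_on k S F"
  shows "C_k_on k S (\<lambda>x. c *\<^sub>R F x)"
  using assms(2)
proof (induction k arbitrary: F)
  case 0
  then show ?case by (auto intro: continuous_intros)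
next
  case (Suc k)
  have deriv: "((\<lambda>x. c *\<^sub>R F x) has_derivative (\<lambda>v. c *\<^sub>R frechet_derivative F (at x) v)) (at x)"
    if "x \<in> S" for x
  proof (rule has_derivative_scaleR_right)
    show "(F has_derivative frechet_derivative F (at x)) (at x)"
      using Suc.prems that by (simp add: frechet_derivative_works)
  qed
  have eq: "frechet_derivative (\<lambda>x. c *\<^sub>R F x) (at x) = (\<lambda>v. c *\<^sub>R frechet_derivative F (at x) v)"
    if "x \<in> S" for x
    using frechet_derivative_at[OF deriv[OF that]] by (rule sym)
  have "(\<lambda>x. c *\<^sub>R F x) differentiable (at x)" if "x \<in> S" for x
    using deriv[OF that] by (rule differentiableI)
  moreover have "C_k_on k S (\<lambda>x. frechet_derivative (\<lambda>x. c *\<^sub>R F x) (at x) v)" for v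
  proof (rule C_k_on_cong[OF \<open>open S\<close>])
    show "C_k_on k S (\<lambda>x. c *\<^sub>R frechet_derivative F (at x) v)"
      using Suc.IH[of "\<lambda>x. frechet_derivative F (at x) v"] Suc.prems by simp
  qed (simp add: eq)
  ultimately show ?case by simp
qed

text \<open>The derivative at \<open>t\<close> applied to \<open>s\<close> is \<open>s\<close> times
  the directional derivative of \<open>F\<close> along \<open>v\<close>, again a function composed
  with the same line. Induction over all \<open>F\<close> therefore needs only scalar multiples and
  no general chain rule for higher derivatives.\<close>

lemma C_k_on_line:
  fixes F :: "'a::euclidean_space \<Rightarrow> 'b::euclidean_space" and I :: "real set"
  assumes "open I" "\<And>t. t \<in> I \<Longrightarrow> u + t *\<^sub>R v \<in> S" "C_k_on k S F"
  shows "C_k_on k I (\<lambda>t. F (u + t *\<^sub>R v))"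
  using assms(3)
proof (induction k arbitrary: F)
  case 0
  then show ?case
    using assms(2) by (auto intro!: continuous_on_compose2[of S F] continuous_intros)
next
  case (Suc k)
  let ?D = "\<lambda>t. frechet_derivative F (at (u + t *\<^sub>R v))"
  have deriv: "((\<lambda>t. F (u + t *\<^sub>R v)) has_derivative (\<lambda>s. ?D t (s *\<^sub>R v))) (at t)"
    if "t \<in> I" for t
  proof -
    have "((\<lambda>t. u + t *\<^sub>R v) has_derivative (\<lambda>s. s *\<^sub>R v)) (at t)"
      by (auto intro!: derivative_eq_intros)
    moreover have "(F has_derivative ?D t) (at (u + t *\<^sub>R v))"
      using Suc.prems assms(2) that by (auto simp: frechet_derivative_works)
    ultimately show ?thesis using has_derivative_compose by fast
  qed
  have eq: "s *\<^sub>R ?D t v = frechet_derivative (\<lambda>t. F (u + t *\<^sub>R v)) (at t) s" if "t \<in> I" for t s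
  proof -
    have "linear (?D t)"
      using Suc.prems assms(2) that by (auto intro: linear_frechet_derivative)
    then show ?thesis
      using fun_cong[OF frechet_derivative_at[OF deriv[OF that]], of s] by (simp add: linear_scale)
  qed
  have "(\<lambda>t. F (u + t *\<^sub>R v)) differentiable (at t)" if "t \<in> I" for t
    using deriv[OF that] by (rule differentiableI)
  moreover have "C_k_on k I (\<lambda>t. frechet_derivative (\<lambda>t. F (u + t *\<^sub>R v)) (at t) s)" for s
  proof (rule C_k_on_cong[OF \<open>open I\<close>])
    show "C_k_on k I (\<lambda>t. s *\<^sub>R ?D t v)"
      using Suc.prems by (intro C_k_on_scaleR \<open>open I\<close> Suc.IH[of "\<lambda>x. frechet_derivative F (at x) v"]) simp
  qed (rule eq)
  ultimately show ?case by simp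
qed

lemma smooth_on_open_continuous: "smooth_on_open S F \<Longrightarrow> continuous_on S F"
  unfolding smooth_on_open_def by (metis C_k_on.simps(1))

lemma smooth_on_open_has_derivative:
  assumes "smooth_on_open S F" "x \<in> S"
  shows "(F has_derivative frechet_derivative F (at x)) (at x)"
proof -
  have "C_k_on (Suc 0) S F" using assms(1) unfolding smooth_on_open_def by blast
  then show ?thesis using assms(2) by (auto simp: frechet_derivative_works)
qed

text \<open>Near \<open>p\<close>, \<open>F\<close> agrees on the relatively open set
  \<open>M \<inter> U\<close> with a smooth ambient map, and continuity within \<open>M\<close> sees
  only such a neighbourhood.\<close>

lemma smooth_on_subset_continuous:
  assumes "smooth_on_subset M F"
  shows "continuous_on M F"
  unfolding continuous_on_eq_continuous_within
proof
  fix p assume "p \<in> M"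
  then obtain U G where U: "open U" "p \<in> U" "smooth_on_open U G" "\<forall>x\<in>M \<inter> U. G x = F x"
    using assms unfolding smooth_on_subset_def by metis
  have "continuous (at p within M) G"
    using U continuous_on_eq_continuous_at smooth_on_open_continuous continuous_at_imp_continuous_at_within
    by metis
  then show "continuous (at p within M) F"
  proof (rule continuous_transform_within_openin[where S = "M \<inter> U" and T = M])
  qed (use U \<open>p \<in> M\<close> in \<open>auto intro: openin_open_Int\<close>)
qed

section \<open>Tangent vectors obtained from parametrizations\<close>

text \<open>The witness curve is the image under \<open>\<sigma>\<close> of the line through
  \<open>u\<close> in direction \<open>v\<close>, on an interval so short that the line stays in
  \<open>V\<close>. This makes the metric axioms, stated for tangent vectors only, available in
  coordinates.\<close>

lemma derivative_in_tangent_space: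
  assumes "local_parametrization M V \<sigma>" "u \<in> V"
  shows "frechet_derivative \<sigma> (at u) v \<in> tangent_space M (\<sigma> u)"
proof -
  have V: "open V" "smooth_on_open V \<sigma>" "openin (top_of_set M) (\<sigma> ` V)"
    using assms(1) by (auto simp: local_parametrization_def)
  then have sub: "\<sigma> ` V \<subseteq> M" using openin_imp_subset by blast
  have "open ((\<lambda>t. u + t *\<^sub>R v) -` V)"
    by (intro open_vimage V continuous_intros)
  moreover have "(0::real) \<in> (\<lambda>t. u + t *\<^sub>R v) -` V" using assms(2) by simp
  ultimately obtain e :: real where e: "e > 0" "ball 0 e \<subseteq> (\<lambda>t. u + t *\<^sub>R v) -` V"
    by (meson openE)
  then have in_V: "u + t *\<^sub>R v \<in> V" if "t \<in> {-e<..<e}" for t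
    using that by (auto simp: subset_iff dist_real_def)
  have D: "(\<sigma> has_derivative frechet_derivative \<sigma> (at u)) (at u)"
    by (rule smooth_on_open_has_derivative[OF V(2) assms(2)])
  have "((\<lambda>t. \<sigma> (u + t *\<^sub>R v)) has_derivative (\<lambda>s. frechet_derivative \<sigma> (at u) (s *\<^sub>R v))) (at 0)"
  proof -
    have "((\<lambda>t. u + t *\<^sub>R v) has_derivative (\<lambda>s. s *\<^sub>R v)) (at 0)"
      by (auto intro!: derivative_eq_intros)
    moreover have "(\<sigma> has_derivative frechet_derivative \<sigma> (at u)) (at (u + 0 *\<^sub>R v))"
      using D by simp
    ultimately show ?thesis using has_derivative_compose by fast
  qed
  then have "((\<lambda>t. \<sigma> (u + t *\<^sub>R v)) has_vector_derivative frechet_derivative \<sigma> (at u) v) (at 0)"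
    by (simp add: has_vector_derivative_def linear_scale[OF has_derivative_linear[OF D]])
  moreover have "smooth_on_open {-e<..<e} (\<lambda>t. \<sigma> (u + t *\<^sub>R v))"
    using V(2) in_V C_k_on_line[of "{-e<..<e}" u v V _ \<sigma>] by (auto simp: smooth_on_open_def)
  ultimately have "curve_with_velocity M (\<sigma> u) (frechet_derivative \<sigma> (at u) v) (\<lambda>t. \<sigma> (u + t *\<^sub>R v))"
    using e(1) in_V sub by (auto simp: curve_with_velocity_def intro!: exI[of _ e])
  then show ?thesis by (auto simp: tangent_space_def)
qed

subsection \<open>Positivity and local bounds of the volume density\<close>

text \<open>The determinant does not vanish on the segment from the identity matrix to \<open>A\<close>.\<close>

lemma det_pos_definite:
  fixes A :: "real^'n^'n"
  assumes pos: "\<And>x. x \<noteq> 0 \<Longrightarrow> x \<bullet> (A *v x) > 0"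
  shows "det A > 0"
proof (rule ccontr)
  let ?B = "\<lambda>t::real. (1 - t) *\<^sub>R mat 1 + t *\<^sub>R A"
  assume "\<not> det A > 0"
  moreover have "continuous_on {0..1} (\<lambda>t. det (?B t))"
    unfolding det_def by (intro continuous_intros continuous_on_component)
  \<comment> \<open>The determinant is 1 at \<open>t = 0\<close> and at most 0 at
    \<open>t = 1\<close>, so it vanishes in between.\<close>
  ultimately obtain t where t: "0 \<le> t" "t \<le> 1" "det (?B t) = 0"
    using IVT2'[of "\<lambda>t. det (?B t)" 1 0 0] by (auto simp: det_I)
  then obtain x where x: "x \<noteq> 0" "?B t *v x = 0"
    using invertible_det_nz[of "?B t"] matrix_left_invertible_ker[of "?B t"]
    by (auto simp: invertible_left_inverse)
  \<comment> \<open>Pairing the kernel vector with itself gives a convex combination of two positive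
    numbers, which cannot be zero.\<close>
  have "0 = (1 - t) * (x \<bullet> x) + t * (x \<bullet> (A *v x))"
    using arg_cong[OF x(2), of "\<lambda>y. x \<bullet> y"]
    by (simp add: matrix_vector_mult_add_rdistrib scaleR_matrix_vector_assoc[symmetric] inner_add_right)
  moreover have "x \<bullet> x > 0" "x \<bullet> (A *v x) > 0" using x(1) pos by auto
  ultimately show False
    using t by (smt (verit) mult_nonneg_nonneg mult_pos_pos)
qed

text \<open>The matrix is the Gram matrix of the images of the coordinate vectors. Its quadratic
  form at \<open>x\<close> is the squared \<open>g\<close>-length of the image of \<open>x\<close>,
  which is positive because the derivative of \<open>\<sigma>\<close> is injective.\<close>

lemma det_metric_matrix_pos:
  fixes \<sigma> :: "real^'n \<Rightarrow> 'a::euclidean_space"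
  assumes g: "riemannian_metric TYPE('n) M g"
    and \<sigma>: "local_parametrization M V \<sigma>" and u: "u \<in> V"
  shows "det (metric_matrix g \<sigma> u) > 0"
proof (rule det_pos_definite)
  fix x :: "real^'n" assume "x \<noteq> 0"
  let ?D = "frechet_derivative \<sigma> (at u)"
  have V: "smooth_on_open V \<sigma>" "inj ?D" "openin (top_of_set M) (\<sigma> ` V)"
    using \<sigma> u by (auto simp: local_parametrization_def)
  have p: "\<sigma> u \<in> M" using V(3) u openin_imp_subset by blast
  have lin: "linear ?D"
    using smooth_on_open_has_derivative[OF V(1) u] has_derivative_linear by blast
  note tan = derivative_in_tangent_space[OF \<sigma> u]
  have sym: "g (\<sigma> u) (?D v) (?D w) = g (\<sigma> u) (?D w) (?D v)" for v w
    using g p tan by (simp add: riemannian_metric_def)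
  have bilin: "g (\<sigma> u) (a *\<^sub>R ?D v + b *\<^sub>R ?D w) (?D z) = a * g (\<sigma> u) (?D v) (?D z) + b * g (\<sigma> u) (?D w) (?D z)"
    for a b v w z
    using g p tan by (simp add: riemannian_metric_def)
  \<comment> \<open>Coefficients 1 and 1 in the combination axiom give additivity, \<open>c\<close>
    and 0 give homogeneity.\<close>
  have lin_g: "linear (\<lambda>v. g (\<sigma> u) (?D v) (?D w))" for w
  proof (rule linearI)
    show "g (\<sigma> u) (?D (v + v')) (?D w) = g (\<sigma> u) (?D v) (?D w) + g (\<sigma> u) (?D v') (?D w)" for v v'
      using bilin[of 1 v 1 v' w] by (simp add: linear_add[OF lin])
    show "g (\<sigma> u) (?D (c *\<^sub>R v)) (?D w) = c *\<^sub>R g (\<sigma> u) (?D v) (?D w)" for c v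
      using bilin[of c v 0 v w] by (simp add: linear_scale[OF lin])
  qed
  have expand: "g (\<sigma> u) (?D v) (?D w) = (\<Sum>i\<in>UNIV. v $ i * g (\<sigma> u) (?D (axis i 1)) (?D w))" for v w
  proof -
    have "g (\<sigma> u) (?D v) (?D w) = g (\<sigma> u) (?D (\<Sum>i\<in>UNIV. (v $ i) *\<^sub>R axis i 1)) (?D w)"
      using basis_expansion[of v] by (simp add: scalar_mult_eq_scaleR)
    also have "\<dots> = (\<Sum>i\<in>UNIV. g (\<sigma> u) (?D ((v $ i) *\<^sub>R axis i 1)) (?D w))"
      by (rule linear_sum[OF lin_g])
    also have "\<dots> = (\<Sum>i\<in>UNIV. v $ i * g (\<sigma> u) (?D (axis i 1)) (?D w))"
      by (intro sum.cong refl) (simp add: linear_scale[OF lin_g])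
    finally show ?thesis .
  qed
  have "x \<bullet> (metric_matrix g \<sigma> u *v x) = g (\<sigma> u) (?D x) (?D x)"
    unfolding expand[of x x] inner_vec_def inner_real_def
  proof (intro sum.cong refl arg_cong2[where f = "(*)"])
    fix i
    show "(metric_matrix g \<sigma> u *v x) $ i = g (\<sigma> u) (?D (axis i 1)) (?D x)"
      \<comment> \<open>The expansion acts on the first slot only, so symmetry moves
        \<open>x\<close> there; a second use of symmetry restores the index order of the matrix
        entries.\<close>
      unfolding sym[of "axis i 1" x] expand[of x "axis i 1"]
      by (simp add: matrix_vector_mult_def metric_matrix_def mult.commute sym[of _ "axis i 1"])
  qed
  moreover have "?D x \<noteq> 0"
    using \<open>x \<noteq> 0\<close> V(2) linear_0[OF lin] by (metis injD)
  then have "g (\<sigma> u) (?D x) (?D x) > 0"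
    using g p tan by (simp add: riemannian_metric_def)
  ultimately show "x \<bullet> (metric_matrix g \<sigma> u *v x) > 0" by simp
qed

section \<open>Volume of relatively open sets and of the whole manifold\<close>

lemma riemannian_density_open_sets:
  assumes "riemannian_density TYPE('n::finite) M g vol" "openin (top_of_set M) U"
  shows "U \<in> sets vol"
proof -
  obtain T where "open T" "U = M \<inter> T" using assms(2) by (auto simp: openin_open)
  then have "U \<in> sets (restrict_space borel M)"
    unfolding sets_restrict_space by (metis borel_open imageI)
  then show ?thesis using assms(1) by (simp add: riemannian_density_def)
qed

text \<open>On a small coordinate ball the volume density lies between two positive constants, so
  the volume of its image is comparable to Lebesgue measure. Finiteness feeds the compactness
  argument for the total volume; positivity feeds the lower bound for the normalising
  constant.\<close>

lemma riemannian_density_neighbourhood: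
  fixes M :: "'a::euclidean_space set"
  assumes M: "embedded_submanifold TYPE('n::finite) M"
    and g: "riemannian_metric TYPE('n) M g"
    and vol: "riemannian_density TYPE('n) M g vol"
    and W: "openin (top_of_set M) W" and p: "p \<in> W"
  obtains A where "openin (top_of_set M) A" "p \<in> A" "A \<subseteq> W" "0 < emeasure vol A" "emeasure vol A < \<infinity>"
proof -
  have "p \<in> M" using W p openin_imp_subset by blast
  then obtain V :: "(real^'n) set" and \<sigma> where \<sigma>: "local_parametrization M V \<sigma>" and pV: "p \<in> \<sigma> ` V"
    using M unfolding embedded_submanifold_def by meson
  then obtain u where u: "u \<in> V" "\<sigma> u = p" by blast
  have V: "open V" "openin (top_of_set M) (\<sigma> ` V)" "homeomorphism V (\<sigma> ` V) \<sigma> (inv_into V \<sigma>)"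
    using \<sigma> by (auto simp: local_parametrization_def)
  have cont: "continuous_on V \<sigma>" and inj: "inj_on \<sigma> V"
    using V(3) by (auto simp: homeomorphism_def intro: inj_on_inverseI)
  obtain T where T: "open T" "W = M \<inter> T" using W by (auto simp: openin_open)
  have "open (V \<inter> \<sigma> -` T)" using cont T V(1) by (simp add: continuous_open_preimage)
  moreover have "u \<in> V \<inter> \<sigma> -` T" using u p T(2) by simp
  \<comment> \<open>The closed ball is kept inside the chart so that the density attains its extrema
    on a compact set; the image of the open ball becomes the neighbourhood.\<close>
  ultimately obtain e where e: "e > 0" "cball u e \<subseteq> V \<inter> \<sigma> -` T"
    by (metis open_contains_cball)
  let ?B = "ball u e" and ?h = "\<lambda>x. sqrt (det (metric_matrix g \<sigma> x))"
  have BV: "?B \<subseteq> V" using e ball_subset_cball by blast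
  have "openin (top_of_set (\<sigma> ` V)) (\<sigma> ` ?B)"
    by (rule homeomorphism_imp_open_map[OF V(3)]) (use BV in \<open>auto simp: openin_open_eq V(1)\<close>)
  then have op: "openin (top_of_set M) (\<sigma> ` ?B)" using V(2) openin_trans by blast
  have sub: "\<sigma> ` ?B \<subseteq> W"
  proof -
    have "\<sigma> ` ?B \<subseteq> T" using e ball_subset_cball[of u e] by blast
    then show ?thesis using openin_imp_subset[OF op] T(2) by blast
  qed
  have "\<sigma> ` ?B \<in> sets vol"
    using vol op by (rule riemannian_density_open_sets)
  moreover have "V \<inter> \<sigma> -` \<sigma> ` ?B = ?B"
    using BV inj_on_image_mem_iff[OF inj _ BV] by blast
  moreover have "\<sigma> ` ?B \<subseteq> \<sigma> ` V" using BV by (rule image_mono)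
  moreover have "emeasure vol A = (\<integral>\<^sup>+x. ennreal (?h x) * indicator (V \<inter> \<sigma> -` A) x \<partial>lborel)"
    if "A \<in> sets vol" "A \<subseteq> \<sigma> ` V" for A
    using vol \<sigma> that unfolding riemannian_density_def by blast
  ultimately have emeas: "emeasure vol (\<sigma> ` ?B) = (\<integral>\<^sup>+x. ennreal (?h x) * indicator ?B x \<partial>lborel)"
    by metis
  have "continuous_on V (\<lambda>x. metric_matrix g \<sigma> x $ i $ j)" for i j
    using g \<sigma> by (auto simp: riemannian_metric_def intro: smooth_on_open_continuous)
  \<comment> \<open>The determinant is a polynomial in the continuous matrix entries.\<close>
  then have "continuous_on V ?h"
    unfolding det_def
    by (intro continuous_on_real_sqrt continuous_on_sum continuous_on_mult continuous_on_const
        continuous_on_prod)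
  then have h: "continuous_on (cball u e) ?h" by (rule continuous_on_subset) (use e in blast)
  have ne: "cball u e \<noteq> {}" using e by auto
  obtain a where a: "a \<in> cball u e" "\<And>x. x \<in> cball u e \<Longrightarrow> ?h a \<le> ?h x"
    using continuous_attains_inf[OF compact_cball ne h] by blast
  obtain b where b: "b \<in> cball u e" "\<And>x. x \<in> cball u e \<Longrightarrow> ?h x \<le> ?h b"
    using continuous_attains_sup[OF compact_cball ne h] by blast
  have "?h a > 0" using det_metric_matrix_pos[OF g \<sigma>] a e by auto
  have "0 < ennreal (?h a) * emeasure lborel ?B"
  proof -
    have "emeasure lborel ?B \<noteq> 0"
      using open_not_negligible[of ?B] e by (auto simp: emeasure_lborel_ball_finite negligible_iff_emeasure0)
    then show ?thesis using \<open>?h a > 0\<close> by (simp add: ennreal_zero_less_mult_iff zero_less_iff_neq_zero)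
  qed
  also have "\<dots> = (\<integral>\<^sup>+x. ennreal (?h a) * indicator ?B x \<partial>lborel)"
    by (simp add: nn_integral_cmult_indicator)
  also have "\<dots> \<le> emeasure vol (\<sigma> ` ?B)"
    unfolding emeas using a(2) by (intro nn_integral_mono) (auto split: split_indicator intro!: ennreal_leI)
  finally have pos: "0 < emeasure vol (\<sigma> ` ?B)" .
  have "emeasure vol (\<sigma> ` ?B) \<le> (\<integral>\<^sup>+x. ennreal (?h b) * indicator ?B x \<partial>lborel)"
    unfolding emeas using b(2) by (intro nn_integral_mono) (auto split: split_indicator intro!: ennreal_leI)
  also have "\<dots> = ennreal (?h b) * emeasure lborel ?B"
    by (simp add: nn_integral_cmult_indicator)
  also have "\<dots> < \<infinity>"
    using emeasure_lborel_ball_finite[of u e] by (simp add: ennreal_mult_less_top)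
  finally have fin: "emeasure vol (\<sigma> ` ?B) < \<infinity>" .
  show ?thesis
    by (rule that[OF op _ sub pos fin]) (use u e in auto)
qed

text \<open>Every point has a relatively open neighbourhood of finite volume; compactness leaves
  finitely many of them, and subadditivity bounds the total.\<close>

lemma finite_measure_riemannian_density:
  assumes M: "embedded_submanifold TYPE('n::finite) M" and "compact M"
    and g: "riemannian_metric TYPE('n) M g"
    and vol: "riemannian_density TYPE('n) M g vol"
  shows "finite_measure vol"
proof
  have space: "space vol = M" using vol by (auto simp: riemannian_density_def)
  have "\<exists>T. open T \<and> p \<in> T \<and> emeasure vol (M \<inter> T) < \<infinity>" if "p \<in> M" for p
    using riemannian_density_neighbourhood[OF M g vol openin_subtopology_self that]
    by (metis (no_types, lifting) IntD2 openin_open)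
  then obtain T where T: "\<And>p. p \<in> M \<Longrightarrow> open (T p) \<and> p \<in> T p \<and> emeasure vol (M \<inter> T p) < \<infinity>"
    by metis
  obtain P where P: "P \<subseteq> M" "finite P" "M \<subseteq> (\<Union>p\<in>P. T p)"
  proof (rule compactE_image[OF \<open>compact M\<close>, of M T])
    show "M \<subseteq> (\<Union>p\<in>M. T p)" using T by blast
  qed (use T in auto)
  have meas: "M \<inter> T p \<in> sets vol" if "p \<in> P" for p
    using riemannian_density_open_sets[OF vol openin_open_Int] T P(1) that by blast
  have "emeasure vol (space vol) \<le> emeasure vol (\<Union>p\<in>P. M \<inter> T p)"
    using P meas by (intro emeasure_mono sets.finite_UN) (auto simp: space)
  also have "\<dots> \<le> (\<Sum>p\<in>P. emeasure vol (M \<inter> T p))"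
    using P(2) meas by (intro emeasure_subadditive_finite) auto
  also have "\<dots> < \<infinity>" using P T by (auto simp: less_top[symmetric])
  finally show "emeasure vol (space vol) \<noteq> \<infinity>" by simp
qed

subsection \<open>Concentration of Gibbs measures\<close>

text \<open>Integrability holds because the weight is bounded by
  \<open>exp (- 2 * \<kappa> * m)\<close> on a finite measure space. The lower bound keeps only the
  contribution of \<open>V\<close>, where the weight is at least
  \<open>exp (- 2 * \<kappa> * a)\<close>.\<close>

lemma gibbs_constant_ge:
  assumes vol: "finite_measure vol" and meas: "\<phi> \<in> borel_measurable vol"
    and m: "\<And>x. x \<in> space vol \<Longrightarrow> m \<le> \<phi> x" and "\<kappa> > 0"
    and V: "V \<in> sets vol" "\<And>x. x \<in> V \<Longrightarrow> \<phi> x \<le> a"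
  shows "integrable vol (\<lambda>x. exp (- 2 * \<kappa> * \<phi> x))"
    and "exp (- 2 * \<kappa> * a) * measure vol V \<le> gibbs_constant vol \<phi> \<kappa>"
proof -
  interpret finite_measure vol by fact
  show int: "integrable vol (\<lambda>x. exp (- 2 * \<kappa> * \<phi> x))"
    using meas m \<open>\<kappa> > 0\<close>
    by (intro integrable_const_bound[where B = "exp (- 2 * \<kappa> * m)"] AE_I2) auto
  have "exp (- 2 * \<kappa> * a) * measure vol V = (\<integral>x. exp (- 2 * \<kappa> * a) * indicator V x \<partial>vol)"
    using V(1) sets.sets_into_space[OF V(1)] by (simp add: Int_absorb2)
  also have "\<dots> \<le> (\<integral>x. exp (- 2 * \<kappa> * \<phi> x) \<partial>vol)"
    using V \<open>\<kappa> > 0\<close> int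
    by (intro integral_mono integrable_mult_right integrable_real_indicator)
       (auto split: split_indicator simp: emeasure_eq_measure)
  finally show "exp (- 2 * \<kappa> * a) * measure vol V \<le> gibbs_constant vol \<phi> \<kappa>"
    by (simp add: gibbs_constant_def)
qed

text \<open>The weight on \<open>K\<close> is at most \<open>exp (- 2 * \<kappa> * b)\<close>, while
  the normalising constant is at least the contribution of \<open>V\<close>. In the quotient only
  the gap \<open>b - a\<close> survives in the exponent, and the prefactor is free of
  \<open>\<kappa>\<close>.\<close>

lemma gibbs_measure_le:
  assumes vol: "finite_measure vol" and meas: "\<phi> \<in> borel_measurable vol"
    and m: "\<And>x. x \<in> space vol \<Longrightarrow> m \<le> \<phi> x" and "\<kappa> > 0"
    and V: "V \<in> sets vol" "\<And>x. x \<in> V \<Longrightarrow> \<phi> x \<le> a" "measure vol V > 0"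
    and K: "K \<in> sets vol" "\<And>x. x \<in> K \<Longrightarrow> b \<le> \<phi> x"
  shows "emeasure (gibbs_measure vol \<phi> \<kappa>) K
    \<le> ennreal (measure vol (space vol) / measure vol V * exp (- 2 * \<kappa> * (b - a)))"
proof -
  interpret finite_measure vol by fact
  let ?c = "gibbs_constant vol \<phi> \<kappa>" and ?l = "exp (- 2 * \<kappa> * a) * measure vol V"
  have l: "?l \<le> ?c" by (rule gibbs_constant_ge[OF vol meas m \<open>\<kappa> > 0\<close> V(1,2)])
  have "?l > 0" using V(3) by simp
  have "exp (- 2 * \<kappa> * \<phi> x) / ?c \<le> exp (- 2 * \<kappa> * b) / ?l" if "x \<in> K" for x
    using K(2)[OF that] \<open>\<kappa> > 0\<close> l \<open>?l > 0\<close> by (intro frac_le) auto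
  then have "emeasure (gibbs_measure vol \<phi> \<kappa>) K
      \<le> (\<integral>\<^sup>+x. ennreal (exp (- 2 * \<kappa> * b) / ?l) * indicator K x \<partial>vol)"
    unfolding gibbs_measure_def using meas K(1)
    by (subst emeasure_density)
       (auto intro!: nn_integral_mono ennreal_leI split: split_indicator)
  also have "\<dots> = ennreal (exp (- 2 * \<kappa> * b) / ?l * measure vol K)"
    using K(1) \<open>?l > 0\<close>
    by (simp add: nn_integral_cmult_indicator emeasure_eq_measure ennreal_mult[symmetric])
  \<comment> \<open>Passing to the total volume gives a prefactor that stays positive even if
    \<open>K\<close> is a null set.\<close>
  also have "\<dots> \<le> ennreal (exp (- 2 * \<kappa> * b) / ?l * measure vol (space vol))"
    using \<open>?l > 0\<close> by (intro ennreal_leI mult_left_mono bounded_measure) auto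
  also have "exp (- 2 * \<kappa> * b) / ?l * measure vol (space vol)
      = measure vol (space vol) / measure vol V * exp (- 2 * \<kappa> * (b - a))"
    by (simp add: right_diff_distrib exp_diff exp_minus field_simps)
  finally show ?thesis .
qed

text \<open>The set \<open>V\<close> forces the normalising constant to be positive, so the division
  is genuine and the density integrates to 1.\<close>

lemma prob_space_gibbs_measure:
  assumes vol: "finite_measure vol" and meas: "\<phi> \<in> borel_measurable vol"
    and m: "\<And>x. x \<in> space vol \<Longrightarrow> m \<le> \<phi> x" and "\<kappa> > 0"
    and V: "V \<in> sets vol" "\<And>x. x \<in> V \<Longrightarrow> \<phi> x \<le> a" "measure vol V > 0"
  shows "prob_space (gibbs_measure vol \<phi> \<kappa>)"
proof
  let ?c = "gibbs_constant vol \<phi> \<kappa>"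
  note c = gibbs_constant_ge[OF vol meas m \<open>\<kappa> > 0\<close> V(1,2)]
  have "exp (- 2 * \<kappa> * a) * measure vol V > 0" using V(3) by simp
  then have "?c > 0" using c(2) by linarith
  have "emeasure (gibbs_measure vol \<phi> \<kappa>) (space (gibbs_measure vol \<phi> \<kappa>))
      = (\<integral>\<^sup>+x. ennreal (exp (- 2 * \<kappa> * \<phi> x) / ?c) \<partial>vol)"
    unfolding gibbs_measure_def using meas by (simp add: emeasure_density cong: nn_integral_cong)
  also have "\<dots> = ennreal (\<integral>x. exp (- 2 * \<kappa> * \<phi> x) / ?c \<partial>vol)"
    using c(1) \<open>?c > 0\<close> by (intro nn_integral_eq_integral) auto
  also have "\<dots> = ennreal (?c / ?c)" by (simp add: gibbs_constant_def)
  also have "\<dots> = 1" using \<open>?c > 0\<close> by simp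
  finally show "emeasure (gibbs_measure vol \<phi> \<kappa>) (space (gibbs_measure vol \<phi> \<kappa>)) = 1" .
qed

section \<open>Concentration of the Gibbs measures near the minimizers\<close>

theorem lemma1:
  fixes M :: "'a::euclidean_space set"
    and \<phi> :: "'a \<Rightarrow> real"
    and r :: nat
    and f :: "nat \<Rightarrow> 'a \<Rightarrow> 'a"
    and g :: "'a \<Rightarrow> 'a \<Rightarrow> 'a \<Rightarrow> real"
    and vol :: "'a measure"
  assumes "embedded_submanifold TYPE('n::finite) M"
    and "M \<noteq> {}" and "connected M" and "compact M"
    and "orientable_submanifold TYPE('n) M"
    and "smooth_on_subset M \<phi>"
    and "\<And>i. i \<in> {1..r} \<Longrightarrow> smooth_vector_field M (f i)"
    and "\<And>x. x \<in> M \<Longrightarrow> span ((\<lambda>i. f i x) ` {1..r}) = tangent_space M x"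
    and "riemannian_metric TYPE('n) M g"
    and "\<And>\<psi> x. smooth_on_subset M \<psi> \<Longrightarrow> x \<in> M \<Longrightarrow>
           riemannian_gradient M g \<psi> x = (\<Sum>i = 1..r. lie_derivative M (f i) \<psi> x *\<^sub>R f i x)"
    and "riemannian_density TYPE('n) M g vol"
  shows "(\<forall>K. closedin (top_of_set M) K \<and> K \<inter> minimizers M \<phi> = {} \<longrightarrow>
            (\<exists>C>0. \<exists>c>0. \<forall>\<kappa>>0.
               emeasure (gibbs_measure vol \<phi> \<kappa>) K \<le> ennreal (C * exp (- 2 * \<kappa> * c)))) \<and>
         (\<forall>U. openin (top_of_set M) U \<and> minimizers M \<phi> \<subseteq> U \<longrightarrow>
            ((\<lambda>\<kappa>. emeasure (gibbs_measure vol \<phi> \<kappa>) U) \<longlongrightarrow> 1) at_top)"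
proof -
  have space: "space vol = M" and sets: "sets vol = sets (restrict_space borel M)"
    using assms(11) by (auto simp: riemannian_density_def)
  have fin: "finite_measure vol" by (rule finite_measure_riemannian_density) fact+
  then interpret finite_measure vol .
  have cont: "continuous_on M \<phi>" by (rule smooth_on_subset_continuous) fact
  have meas: "\<phi> \<in> borel_measurable vol"
    using borel_measurable_continuous_on_restrict[OF cont] measurable_cong_sets[OF sets refl] by blast
  obtain p where p: "p \<in> M" "\<And>x. x \<in> M \<Longrightarrow> \<phi> p \<le> \<phi> x"
    using continuous_attains_inf[OF \<open>compact M\<close> \<open>M \<noteq> {}\<close> cont] by blast
  \<comment> \<open>The infimum is attained at \<open>p\<close>, so a point of \<open>M\<close> is a
    minimizer as soon as its value does not exceed \<open>\<phi> p\<close>.\<close>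
  then have "(INF y\<in>M. \<phi> y) = \<phi> p" by (intro cInf_eq_minimum) auto
  then have min: "x \<in> minimizers M \<phi>" if "x \<in> M" "\<phi> x \<le> \<phi> p" for x
    using that p by (auto simp: minimizers_def intro: antisym)
  have lower: "\<phi> p \<le> \<phi> x" if "x \<in> space vol" for x using that p space by simp
  let ?V = "\<lambda>a. M \<inter> \<phi> -` {..<a}"
  have V_open: "openin (top_of_set M) (?V a)" for a
    using cont by (simp add: continuous_openin_preimage_gen)
  note open_sets = riemannian_density_open_sets[OF assms(11)]
  note V_sets = open_sets[OF V_open]
  \<comment> \<open>A strict sublevel set above the minimum is relatively open and contains
    \<open>p\<close>, hence a neighbourhood of positive volume.\<close>
  have V_pos: "measure vol (?V a) > 0" if "\<phi> p < a" for a
  proof -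
    have "p \<in> ?V a" using that p(1) by simp
    then obtain A where "A \<subseteq> ?V a" "0 < emeasure vol A"
      by (rule riemannian_density_neighbourhood[OF assms(1,9,11) V_open])
    then have "0 < emeasure vol (?V a)"
      using emeasure_mono[OF _ V_sets] by (metis order_less_le_trans)
    then show ?thesis by (simp add: emeasure_eq_measure)
  qed
  have bound: "\<exists>C>0. \<exists>c>0. \<forall>\<kappa>>0. emeasure (gibbs_measure vol \<phi> \<kappa>) K \<le> ennreal (C * exp (- 2 * \<kappa> * c))"
    if K: "closedin (top_of_set M) K" "K \<inter> minimizers M \<phi> = {}" for K
  proof -
    have KM: "K \<subseteq> M" using K(1) closedin_imp_subset by blast
    have "compact K" using K(1) \<open>compact M\<close> closedin_compact by blast
    \<comment> \<open>For nonempty \<open>K\<close>, \<open>b\<close> is the minimum over the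
      compact set \<open>K\<close>, which exceeds \<open>\<phi> p\<close> because \<open>K\<close>
      misses the minimizers. For empty \<open>K\<close> any larger number serves.\<close>
    have "\<exists>b>\<phi> p. \<forall>x\<in>K. b \<le> \<phi> x"
    proof (cases "K = {}")
      case True
      then show ?thesis using gt_ex by auto
    next
      case False
      obtain q where q: "q \<in> K" "\<And>x. x \<in> K \<Longrightarrow> \<phi> q \<le> \<phi> x"
        using continuous_attains_inf[OF \<open>compact K\<close> False continuous_on_subset[OF cont KM]] by blast
      then have "\<phi> q > \<phi> p" using min K(2) KM by (meson disjoint_iff not_le subsetD)
      then show ?thesis using q by blast
    qed
    then obtain b where b: "\<phi> p < b" "\<And>x. x \<in> K \<Longrightarrow> b \<le> \<phi> x" by blast
    \<comment> \<open>An intermediate level \<open>a\<close> makes both requirements strict: its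
      sublevel set has positive volume, and the rate \<open>c = b - a\<close> is positive. The
      prefactor \<open>C\<close> is the total volume divided by that of the sublevel set.\<close>
    then obtain a where a: "\<phi> p < a" "a < b" using dense by blast
    have K_sets: "K \<in> sets vol"
    proof -
      have "space vol - (M - K) \<in> sets vol"
        using K(1) by (intro sets.compl_sets open_sets) (simp add: openin_diff)
      then show ?thesis using KM by (simp add: space double_diff)
    qed
    have "measure vol (space vol) > 0"
      using V_pos[OF a(1)] bounded_measure[of "?V a"] by linarith
    then show ?thesis
      using gibbs_measure_le[OF fin meas lower _ V_sets _ V_pos[OF a(1)] K_sets b(2)] a V_pos[OF a(1)]
      by (intro exI[of _ "measure vol (space vol) / measure vol (?V a)"] conjI exI[of _ "b - a"]) auto
  qed
  \<comment> \<open>The complement of \<open>U\<close> is closed and misses the minimizers, so its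
    mass decays exponentially, and the mass of \<open>U\<close> is squeezed between
    \<open>1 - C * exp (- 2 * \<kappa> * c)\<close> and 1.\<close>
  moreover have "((\<lambda>\<kappa>. emeasure (gibbs_measure vol \<phi> \<kappa>) U) \<longlongrightarrow> 1) at_top"
    if U: "openin (top_of_set M) U" "minimizers M \<phi> \<subseteq> U" for U
  proof -
    have "closedin (top_of_set M) (M - U)" using U(1) by (simp add: closedin_diff)
    then obtain C c where Cc: "C > 0" "c > 0"
      "\<And>\<kappa>. \<kappa> > 0 \<Longrightarrow> emeasure (gibbs_measure vol \<phi> \<kappa>) (M - U) \<le> ennreal (C * exp (- 2 * \<kappa> * c))"
      using bound[of "M - U"] U(2) by blast
    have lim: "((\<lambda>\<kappa>. 1 - C * exp (- 2 * \<kappa> * c)) \<longlongrightarrow> 1) at_top"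
      using Cc(2) by real_asymp
    have *: "1 - C * exp (- 2 * \<kappa> * c) \<le> measure (gibbs_measure vol \<phi> \<kappa>) U"
      "emeasure (gibbs_measure vol \<phi> \<kappa>) U = ennreal (measure (gibbs_measure vol \<phi> \<kappa>) U)"
      "measure (gibbs_measure vol \<phi> \<kappa>) U \<le> 1" if "\<kappa> > 0" for \<kappa>
    proof -
      \<comment> \<open>Any level above the minimum will do here, since it only certifies that the
        normalising constant is positive.\<close>
      obtain a where a: "\<phi> p < a" using gt_ex by blast
      interpret G: prob_space "gibbs_measure vol \<phi> \<kappa>"
        by (rule prob_space_gibbs_measure[where a = a, OF fin meas lower that V_sets])
           (use V_pos[OF a] in auto)
      have G_space: "space (gibbs_measure vol \<phi> \<kappa>) = M" "sets (gibbs_measure vol \<phi> \<kappa>) = sets vol"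
        by (simp_all add: gibbs_measure_def space)
      have "measure (gibbs_measure vol \<phi> \<kappa>) (M - U) \<le> C * exp (- 2 * \<kappa> * c)"
        using Cc(3)[OF that] Cc(1) by (simp add: G.emeasure_eq_measure)
      then show "1 - C * exp (- 2 * \<kappa> * c) \<le> measure (gibbs_measure vol \<phi> \<kappa>) U"
        using G.prob_compl[of U] open_sets[OF U(1)] by (simp add: G_space)
      show "emeasure (gibbs_measure vol \<phi> \<kappa>) U = ennreal (measure (gibbs_measure vol \<phi> \<kappa>) U)"
        by (rule G.emeasure_eq_measure)
      show "measure (gibbs_measure vol \<phi> \<kappa>) U \<le> 1" by (rule G.prob_le_1)
    qed
    \<comment> \<open>The bounds hold for positive \<open>\<kappa>\<close>, so the threshold 1
      suffices for the limit at infinity.\<close>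
    have "((\<lambda>\<kappa>. measure (gibbs_measure vol \<phi> \<kappa>) U) \<longlongrightarrow> 1) at_top"
      by (rule tendsto_sandwich[OF _ _ lim tendsto_const])
         (use * in \<open>auto intro: eventually_at_top_linorderI[of 1]\<close>)
    then have "((\<lambda>\<kappa>. ennreal (measure (gibbs_measure vol \<phi> \<kappa>) U)) \<longlongrightarrow> 1) at_top"
      using tendsto_ennrealI by fastforce
    then show ?thesis
      by (rule Lim_transform_eventually)
         (use * in \<open>auto intro!: eventually_at_top_linorderI[of 1]\<close>)
  qed
  ultimately show ?thesis by blast
qed

end
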